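(* Let $k\in[K]$ and let $\hat{\mathbf{x}}\in\mathcal{X}^c$. If $\boldsymbol{\delta}\in\Delta_k$ is an optimal solution of the problem $$\min_{\boldsymbol{\delta}\in\Delta_k} J_k(\hat{\mathbf{x}},\boldsymbol{\delta}),$$ then there exists $(\boldsymbol{\alpha},\boldsymbol{\beta},\gamma)\in\mathcal{D}_k$ that is an optimal solution of the linear program $$\min_{(\boldsymbol{\alpha},\boldsymbol{\beta},\gamma)\in\mathcal{D}_k}\ \gamma+\sum_{\ell=1}^{N+1}(\alpha_\ell-\beta_\ell)\,\hat{x}_{i_{k,\ell}}$$ and satisfies $$J_k(\mathbf{x},\boldsymbol{\delta})=\gamma+\sum_{\ell=1}^{N+1}(\alpha_\ell-\beta_\ell)\,x_{i_{k,\ell}}\quad\forall \mathbf{x}\in\mathcal{X}^c.$$ Moreover, if $\boldsymbol{\delta}$ is a Pareto cut in $\Delta_k$, then $(\boldsymbol{\alpha},\boldsymbol{\beta},\gamma)$ is a Pareto cut in $\mathcal{D}_k$.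
   Context: Notation: $[n]=\{1,\ldots,n\}$. There are products $[N+1]$, where product $N+1$ is the no-purchase option, with revenues $r_1,\ldots,r_N>0$ and $r_{N+1}=0$. There are $K$ rankings; for each $k\in[K]$, $i_{k,1},\ldots,i_{k,N+1}$ is a permutation of $[N+1]$ listing the products from most to least preferred by ranking $k$. $L_k$ is the number of products preferred to the no-purchase option by ranking $k$, so $i_{k,L_k+1}=N+1$; it is assumed that $L_k\ge1$ for all $k$. Let $\mathcal{X}^c=\{\mathbf{x}\in[0,1]^{N+1}: x_{N+1}=1\}$. $\mathcal{D}_k$ is the set of $(\boldsymbol{\alpha},\boldsymbol{\beta},\gamma)\in\mathbb{R}^{N+1}\times\mathbb{R}^{N+1}\times\mathbb{R}$ such that, for all $\ell\in[N+1]$, $\gamma+\alpha_\ell-\sum_{\ell'=\ell}^{N+1}\beta_{\ell'}\ge r_{i_{k,\ell}}$ and $\alpha_\ell,\beta_\ell\ge0$. Let $\mathcal{R}_k=\{r_{i_{k,\ell}}:\ell\in\{1,\ldots,L_k+1\}\}$ and $\bar r_k=\max\mathcal{R}_k$. Let $$\Delta_k=\{\boldsymbol{\delta}\in\mathbb{R}^{L_k+1}: 0\le\delta_1\le\cdots\le\delta_{L_k+1}\le\bar r_k\},$$ $$J_k(\mathbf{x},\boldsymbol{\delta})=\delta_{L_k+1}+\sum_{\ell=1}^{L_k}\left(\max\{0,r_{i_{k,\ell}}-\delta_\ell\}-(\delta_{\ell+1}-\delta_\ell)\right)x_{i_{k,\ell}}.$$ Pareto cuts in $\Delta_k$: $\boldsymbol{\delta}\in\Delta_k$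 dominates $\boldsymbol{\delta}'\in\Delta_k$ if $J_k(\mathbf{x},\boldsymbol{\delta})\le J_k(\mathbf{x},\boldsymbol{\delta}')$ for all $\mathbf{x}\in\mathcal{X}^c$, with strict inequality at some $\bar{\mathbf{x}}\in\mathcal{X}^c$; $\boldsymbol{\delta}\in\Delta_k$ is a Pareto cut if no $\boldsymbol{\delta}'\in\Delta_k$ dominates it. Pareto cuts in $\mathcal{D}_k$: $(\boldsymbol{\alpha},\boldsymbol{\beta},\gamma)\in\mathcal{D}_k$ dominates $(\boldsymbol{\alpha}',\boldsymbol{\beta}',\gamma')\in\mathcal{D}_k$ if $\gamma+\sum_{\ell=1}^{N+1}(\alpha_\ell-\beta_\ell)x_{i_{k,\ell}}\le\gamma'+\sum_{\ell=1}^{N+1}(\alpha'_\ell-\beta'_\ell)x_{i_{k,\ell}}$ for all $\mathbf{x}\in\mathcal{X}^c$, with strict inequality at some $\bar{\mathbf{x}}\in\mathcal{X}^c$; an element of $\mathcal{D}_k$ is a Pareto cut if no element of $\mathcal{D}_k$ dominates it. *)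

theory Defs
  imports Complex_Main "HOL-Library.FuncSet"
begin

text \<open>
  Product \<open>N + 1\<close> is the no-purchase option. A ranking is a function \<open>\<sigma>\<close> that permutes
  \<open>{1..N+1}\<close>, where \<open>\<sigma> l\<close> is the \<open>l\<close>-th most preferred product. A vector with \<open>n\<close> real
  entries is an element of \<open>{1..n} \<rightarrow>\<^sub>E UNIV\<close>, so two vectors are equal iff their entries are.
\<close>

definition preferred :: "nat \<Rightarrow> (nat \<Rightarrow> nat) \<Rightarrow> nat \<Rightarrow> nat \<Rightarrow> bool" where
  "preferred N \<sigma> p q \<longleftrightarrow> (\<exists>l\<in>{1..N+1}. \<exists>m\<in>{1..N+1}. l < m \<and> \<sigma> l = p \<and> \<sigma> m = q)"

definition num_preferred :: "nat \<Rightarrow> (nat \<Rightarrow> nat) \<Rightarrow> nat" where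
  "num_preferred N \<sigma> = card {p \<in> {1..N}. preferred N \<sigma> p (N + 1)}"

definition assortments :: "nat \<Rightarrow> (nat \<Rightarrow> real) set" where
  "assortments N = {x \<in> {1..N+1} \<rightarrow>\<^sub>E {0..1}. x (N + 1) = 1}"

definition dual_feasible ::
    "nat \<Rightarrow> (nat \<Rightarrow> real) \<Rightarrow> (nat \<Rightarrow> nat) \<Rightarrow> ((nat \<Rightarrow> real) \<times> (nat \<Rightarrow> real) \<times> real) set" where
  "dual_feasible N r \<sigma> =
    {(\<alpha>, \<beta>, \<gamma>). \<alpha> \<in> {1..N+1} \<rightarrow>\<^sub>E UNIV \<and> \<beta> \<in> {1..N+1} \<rightarrow>\<^sub>E UNIV \<and>
      (\<forall>l\<in>{1..N+1}. \<gamma> + \<alpha> l - (\<Sum>l'=l..N+1. \<beta> l') \<ge> r (\<sigma> l) \<and> \<alpha> l \<ge> 0 \<and> \<beta> l \<ge> 0)}"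

definition dual_cut ::
    "nat \<Rightarrow> (nat \<Rightarrow> nat) \<Rightarrow> (nat \<Rightarrow> real) \<Rightarrow> (nat \<Rightarrow> real) \<times> (nat \<Rightarrow> real) \<times> real \<Rightarrow> real" where
  "dual_cut N \<sigma> x = (\<lambda>(\<alpha>, \<beta>, \<gamma>). \<gamma> + (\<Sum>l=1..N+1. (\<alpha> l - \<beta> l) * x (\<sigma> l)))"

definition max_revenue :: "nat \<Rightarrow> (nat \<Rightarrow> real) \<Rightarrow> (nat \<Rightarrow> nat) \<Rightarrow> real" where
  "max_revenue N r \<sigma> = Max ((\<lambda>l. r (\<sigma> l)) ` {1..num_preferred N \<sigma> + 1})"

definition Delta :: "nat \<Rightarrow> (nat \<Rightarrow> real) \<Rightarrow> (nat \<Rightarrow> nat) \<Rightarrow> (nat \<Rightarrow> real) set" where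
  "Delta N r \<sigma> =
    {\<delta> \<in> {1..num_preferred N \<sigma> + 1} \<rightarrow>\<^sub>E UNIV.
      0 \<le> \<delta> 1 \<and> (\<forall>l\<in>{1..num_preferred N \<sigma>}. \<delta> l \<le> \<delta> (l + 1)) \<and>
      \<delta> (num_preferred N \<sigma> + 1) \<le> max_revenue N r \<sigma>}"

definition J ::
    "nat \<Rightarrow> (nat \<Rightarrow> real) \<Rightarrow> (nat \<Rightarrow> nat) \<Rightarrow> (nat \<Rightarrow> real) \<Rightarrow> (nat \<Rightarrow> real) \<Rightarrow> real" where
  "J N r \<sigma> x \<delta> =
    \<delta> (num_preferred N \<sigma> + 1) +
    (\<Sum>l=1..num_preferred N \<sigma>. (max 0 (r (\<sigma> l) - \<delta> l) - (\<delta> (l + 1) - \<delta> l)) * x (\<sigma> l))"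

text \<open>
  Domination for an arbitrary family of cuts: \<open>F x c\<close> is the value at \<open>x\<close> of the cut given by \<open>c\<close>.
\<close>

definition dominates :: "'x set \<Rightarrow> ('x \<Rightarrow> 'c \<Rightarrow> real) \<Rightarrow> 'c \<Rightarrow> 'c \<Rightarrow> bool" where
  "dominates X F c c' \<longleftrightarrow> (\<forall>x\<in>X. F x c \<le> F x c') \<and> (\<exists>x\<in>X. F x c < F x c')"

definition pareto_cut :: "'x set \<Rightarrow> ('x \<Rightarrow> 'c \<Rightarrow> real) \<Rightarrow> 'c set \<Rightarrow> 'c \<Rightarrow> bool" where
  "pareto_cut X F C c \<longleftrightarrow> c \<in> C \<and> \<not> (\<exists>c'\<in>C. dominates X F c' c)"

lemma no_purchase_position:
  assumes "bij_betw \<sigma> {1..N+1} {1..N+1}"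
  shows "num_preferred N \<sigma> \<le> N" and "\<sigma> (num_preferred N \<sigma> + 1) = N + 1"
proof -
  have inj: "inj_on \<sigma> {1..N+1}" and im: "\<sigma> ` {1..N+1} = {1..N+1}"
    using assms by (auto simp: bij_betw_def)
  have "N + 1 \<in> \<sigma> ` {1..N+1}" unfolding im by simp
  then obtain m where m: "m \<in> {1..N+1}" "\<sigma> m = N + 1" by force
  have "{p \<in> {1..N}. preferred N \<sigma> p (N + 1)} = \<sigma> ` {1..<m}"
  proof (intro equalityI subsetI)
    fix p assume "p \<in> {p \<in> {1..N}. preferred N \<sigma> p (N + 1)}"
    then obtain l m' where lm: "l \<in> {1..N+1}" "m' \<in> {1..N+1}" "l < m'" "\<sigma> l = p" "\<sigma> m' = N + 1"
      unfolding preferred_def by auto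
    then have "m' = m" using inj_onD[OF inj, of m' m] m by simp
    then show "p \<in> \<sigma> ` {1..<m}" using lm by auto
  next
    fix p assume "p \<in> \<sigma> ` {1..<m}"
    then obtain l where l: "l \<in> {1..<m}" "p = \<sigma> l" by auto
    then have l': "l \<in> {1..N+1}" using m by auto
    have "p \<in> {1..N+1}" unfolding l(2) using im l' by blast
    moreover have "p \<noteq> N + 1" using inj_onD[OF inj, of l m] l l' m by auto
    ultimately show "p \<in> {p \<in> {1..N}. preferred N \<sigma> p (N + 1)}"
      unfolding preferred_def using l l' m by force
  qed
  moreover have "card (\<sigma> ` {1..<m}) = m - 1"
    using card_image[OF inj_on_subset[OF inj, of "{1..<m}"]] m by (simp add: subset_eq)
  ultimately have "num_preferred N \<sigma> = m - 1" unfolding num_preferred_def by simp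
  then show "num_preferred N \<sigma> \<le> N" and "\<sigma> (num_preferred N \<sigma> + 1) = N + 1"
    using m by auto
qed

end

theory Submission
  imports Defs
begin

text \<open>
  Both problems describe the same lower envelope of cuts. A dual point \<open>(\<alpha>, \<beta>, \<gamma>)\<close> is best read
  through its levels \<open>\<delta> l = \<gamma> - (\<Sum>l'=l..N+1. \<beta> l')\<close>: nonnegativity of \<open>\<beta>\<close> says that the
  levels are nondecreasing, and feasibility says \<open>\<alpha> l \<ge> max 0 (r (\<sigma> l) - \<delta> l)\<close>. Let \<open>L + 1\<close> be the
  position of the no-purchase option, where every assortment has the value 1.

  From levels to dual points (\<open>dual_point_with_same_cut\<close>): the differences of \<open>\<delta> \<in> Delta\<close> give
  \<open>\<beta>\<close> on the first \<open>L\<close> positions, and \<open>\<alpha>\<close> is as small as feasibility permits. Behind position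
  \<open>L + 1\<close> the products may have revenues above \<open>\<delta> (L + 1)\<close>; they are covered by a large \<open>\<gamma>\<close>, whose
  excess over \<open>\<delta> (L + 1)\<close> is charged to \<open>\<beta> (L + 1)\<close>. The cut does not see this exchange because
  \<open>x (N + 1) = 1\<close>.

  From dual points to levels (\<open>dual_cut_bounded_below_by_J\<close>): the levels of a dual point, truncated
  to the interval from 0 to the largest revenue, lie in \<open>Delta\<close>, and their cut is nowhere above the
  given one. So the cuts of \<open>Delta\<close> are dual cuts, and every dual cut has one of them below it;
  a better or a dominating dual point would yield a better or a dominating element of \<open>Delta\<close>.
\<close>

lemma J_eq_max:
  "J N r \<sigma> x \<delta> = \<delta> (num_preferred N \<sigma> + 1) +
     (\<Sum>l=1..num_preferred N \<sigma>. (max (r (\<sigma> l)) (\<delta> l) - \<delta> (l + 1)) * x (\<sigma> l))"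
proof -
  have "max 0 (a - d) - (d' - d) = max a d - d'" for a d d' :: real
    by (simp add: max_def)
  then show ?thesis unfolding J_def by presburger
qed

text \<open>
  Let \<open>e l\<close> be the amount by which \<open>\<delta> l\<close> exceeds \<open>R\<close>. Since \<open>a l\<close> lies between 0 and \<open>R\<close>, truncation
  raises the \<open>l\<close>-th coefficient by at most \<open>e (l + 1) - e l\<close>. With weights at most 1 these increases
  telescope to at most \<open>e (n + 1)\<close>, which is exactly what the leading term loses.
\<close>

lemma truncating_levels_lowers_cut:
  fixes a x \<delta> :: "nat \<Rightarrow> real" and R :: real and n :: nat
  assumes "0 \<le> R"
    and a: "\<And>l. l \<in> {1..n} \<Longrightarrow> 0 \<le> a l \<and> a l \<le> R"
    and x: "\<And>l. l \<in> {1..n} \<Longrightarrow> 0 \<le> x l \<and> x l \<le> 1"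
    and mono: "\<And>l. l \<in> {1..n} \<Longrightarrow> \<delta> l \<le> \<delta> (l + 1)"
  defines "\<tau> \<equiv> \<lambda>l. max 0 (min R (\<delta> l))"
  shows "\<tau> (n + 1) + (\<Sum>l=1..n. (max (a l) (\<tau> l) - \<tau> (l + 1)) * x l)
    \<le> max 0 (\<delta> (n + 1)) + (\<Sum>l=1..n. (max (a l) (\<delta> l) - \<delta> (l + 1)) * x l)"
proof -
  define e where "e l = max 0 (\<delta> l - R)" for l
  have term_le: "(max (a l) (\<tau> l) - \<tau> (l + 1)) * x l
      \<le> (max (a l) (\<delta> l) - \<delta> (l + 1)) * x l + (e (l + 1) - e l)" if l: "l \<in> {1..n}" for l
  proof -
    have "max (a l) (\<tau> l) - \<tau> (l + 1) \<le> max (a l) (\<delta> l) - \<delta> (l + 1) + (e (l + 1) - e l)"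
      using a[OF l] mono[OF l] \<open>0 \<le> R\<close> unfolding \<tau>_def e_def by (auto simp: max_def min_def)
    then have "(max (a l) (\<tau> l) - \<tau> (l + 1)) * x l
        \<le> (max (a l) (\<delta> l) - \<delta> (l + 1) + (e (l + 1) - e l)) * x l"
      using x[OF l] by (intro mult_right_mono) auto
    also have "\<dots> = (max (a l) (\<delta> l) - \<delta> (l + 1)) * x l + (e (l + 1) - e l) * x l"
      by (simp add: distrib_right)
    also have "(e (l + 1) - e l) * x l \<le> e (l + 1) - e l"
      using x[OF l] mono[OF l] unfolding e_def by (intro mult_left_le) auto
    finally show ?thesis by simp
  qed
  have "(\<Sum>l=1..n. e (l + 1) - e l) = e (n + 1) - e 1"
    using sum_Suc_diff[of 1 n e] by simp
  moreover have "0 \<le> e 1" by (simp add: e_def)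
  ultimately have "(\<Sum>l=1..n. (max (a l) (\<tau> l) - \<tau> (l + 1)) * x l)
      \<le> (\<Sum>l=1..n. (max (a l) (\<delta> l) - \<delta> (l + 1)) * x l) + e (n + 1)"
    using sum_mono[OF term_le, of "{1..n}" "\<lambda>l. l"] by (simp add: sum.distrib)
  moreover have "\<tau> (n + 1) + e (n + 1) = max 0 (\<delta> (n + 1))"
    using \<open>0 \<le> R\<close> unfolding \<tau>_def e_def by (auto simp: max_def min_def)
  ultimately show ?thesis by linarith
qed

lemma sum_split_at_no_purchase:
  fixes f :: "nat \<Rightarrow> real"
  assumes "L \<le> N"
  shows "(\<Sum>l=1..N+1. f l) = (\<Sum>l=1..L. f l) + f (L + 1) + (\<Sum>l=L+2..N+1. f l)"
proof -
  have "{1..N+1} = {1..L} \<union> {L+1..N+1}" using assms by auto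
  then have "(\<Sum>l=1..N+1. f l) = (\<Sum>l=1..L. f l) + (\<Sum>l=L+1..N+1. f l)"
    by (simp add: sum.union_disjoint)
  also have "(\<Sum>l=L+1..N+1. f l) = f (L + 1) + (\<Sum>l=L+2..N+1. f l)"
    using assms sum.atLeast_Suc_atMost[of "L + 1" "N + 1" f] by simp
  finally show ?thesis by simp
qed

lemma assortment_at_position:
  assumes "bij_betw \<sigma> {1..N+1} {1..N+1}" and "x \<in> assortments N" and "l \<in> {1..N+1}"
  shows "0 \<le> x (\<sigma> l) \<and> x (\<sigma> l) \<le> 1"
proof -
  have "\<sigma> l \<in> {1..N+1}" using bij_betwE[OF assms(1)] assms(3) by blast
  then have "x (\<sigma> l) \<in> {0..1}" using assms(2) unfolding assortments_def by blast
  then show ?thesis by simp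
qed

lemma assortment_at_no_purchase:
  assumes "bij_betw \<sigma> {1..N+1} {1..N+1}" and "x \<in> assortments N"
  shows "x (\<sigma> (num_preferred N \<sigma> + 1)) = 1"
  using assms(2) unfolding no_purchase_position(2)[OF assms(1)] by (simp add: assortments_def)

lemma dual_point_with_same_cut:
  assumes bij: "bij_betw \<sigma> {1..N+1} {1..N+1}"
    and r0: "r (N + 1) = 0"
    and \<delta>: "\<delta> \<in> Delta N r \<sigma>"
  obtains \<alpha> \<beta> \<gamma> where "(\<alpha>, \<beta>, \<gamma>) \<in> dual_feasible N r \<sigma>"
    and "\<And>x. x \<in> assortments N \<Longrightarrow> J N r \<sigma> x \<delta> = dual_cut N \<sigma> x (\<alpha>, \<beta>, \<gamma>)"
proof -
  define L where "L = num_preferred N \<sigma>"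
  have LN: "L \<le> N" and sL: "\<sigma> (L + 1) = N + 1"
    using no_purchase_position[OF bij] unfolding L_def by auto
  have \<delta>1: "0 \<le> \<delta> 1" and mono: "\<And>l. l \<in> {1..L} \<Longrightarrow> \<delta> l \<le> \<delta> (l + 1)"
    using \<delta> unfolding Delta_def L_def by auto
  have nonneg: "0 \<le> \<delta> (Suc m)" if "m \<le> L" for m
    using that
  proof (induction m)
    case 0
    then show ?case using \<delta>1 by simp
  next
    case (Suc m)
    then show ?case using mono[of "Suc m"] by simp
  qed
  \<comment> \<open>Any common upper bound of \<open>\<delta> (L + 1)\<close> and of all revenues does as \<open>\<gamma>\<close>.\<close>
  define \<gamma> where "\<gamma> = Max (insert (\<delta> (L + 1)) ((\<lambda>l. r (\<sigma> l)) ` {1..N+1}))"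
  have \<gamma>\<delta>: "\<delta> (L + 1) \<le> \<gamma>" unfolding \<gamma>_def by simp
  have \<gamma>r: "r (\<sigma> l) \<le> \<gamma>" if "l \<in> {1..N+1}" for l
    unfolding \<gamma>_def using that by (intro Max_ge) auto
  define \<alpha> where "\<alpha> = restrict (\<lambda>l. if l \<le> L then max 0 (r (\<sigma> l) - \<delta> l) else 0) {1..N+1}"
  define \<beta> where "\<beta> = restrict (\<lambda>l. if l \<le> L then \<delta> (l + 1) - \<delta> l
      else if l = L + 1 then \<gamma> - \<delta> (L + 1) else 0) {1..N+1}"
  have \<alpha>_front: "\<alpha> l = max 0 (r (\<sigma> l) - \<delta> l)" and \<beta>_front: "\<beta> l = \<delta> (l + 1) - \<delta> l"
    if "l \<in> {1..L}" for l
    using that LN unfolding \<alpha>_def \<beta>_def by auto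
  have \<alpha>_L: "\<alpha> (L + 1) = 0" and \<beta>_L: "\<beta> (L + 1) = \<gamma> - \<delta> (L + 1)"
    using LN unfolding \<alpha>_def \<beta>_def by auto
  have \<alpha>_back: "\<alpha> l = 0" and \<beta>_back: "\<beta> l = 0" if "l \<in> {L+2..N+1}" for l
    using that unfolding \<alpha>_def \<beta>_def by auto
  have tail_back: "(\<Sum>l'=l..N+1. \<beta> l') = 0" if "L + 2 \<le> l" for l
    using that \<beta>_back by (intro sum.neutral) auto
  \<comment> \<open>The levels of the dual point are \<open>\<delta>\<close> up to position \<open>L + 1\<close>.\<close>
  have tail_front: "(\<Sum>l'=l..N+1. \<beta> l') = \<gamma> - \<delta> l" if "1 \<le> l" "l \<le> L + 1" for l
    using that(2,1)
  proof (induction l rule: inc_induct)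
    case base
    have "(\<Sum>l'=L+1..N+1. \<beta> l') = \<beta> (L + 1) + (\<Sum>l'=L+2..N+1. \<beta> l')"
      using LN sum.atLeast_Suc_atMost[of "L + 1" "N + 1" \<beta>] by simp
    then show ?case using tail_back[of "L + 2"] \<beta>_L by simp
  next
    case (step l)
    have "(\<Sum>l'=l..N+1. \<beta> l') = \<beta> l + (\<Sum>l'=Suc l..N+1. \<beta> l')"
      using step.hyps LN by (intro sum.atLeast_Suc_atMost) auto
    then show ?case using step \<beta>_front[of l] by simp
  qed
  have feas: "r (\<sigma> l) \<le> \<gamma> + \<alpha> l - (\<Sum>l'=l..N+1. \<beta> l') \<and> 0 \<le> \<alpha> l \<and> 0 \<le> \<beta> l"
    if l: "l \<in> {1..N+1}" for l
  proof -
    consider "l \<in> {1..L}" | "l = L + 1" | "l \<in> {L+2..N+1}" using l by fastforce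
    then show ?thesis
    proof cases
      case 1
      then show ?thesis using \<alpha>_front[of l] \<beta>_front[of l] tail_front[of l] mono[of l] by auto
    next
      case 2
      then show ?thesis using \<alpha>_L \<beta>_L tail_front[of l] nonneg[of L] \<gamma>\<delta> sL r0 by simp
    next
      case 3
      then show ?thesis using \<alpha>_back[of l] \<beta>_back[of l] tail_back[of l] \<gamma>r[OF l] by simp
    qed
  qed
  have "\<alpha> \<in> {1..N+1} \<rightarrow>\<^sub>E UNIV" "\<beta> \<in> {1..N+1} \<rightarrow>\<^sub>E UNIV"
    unfolding \<alpha>_def \<beta>_def by auto
  then have "(\<alpha>, \<beta>, \<gamma>) \<in> dual_feasible N r \<sigma>"
    unfolding dual_feasible_def using feas by blast
  moreover have "J N r \<sigma> x \<delta> = dual_cut N \<sigma> x (\<alpha>, \<beta>, \<gamma>)" if x: "x \<in> assortments N" for x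
  proof -
    have "(\<Sum>l=1..L. (\<alpha> l - \<beta> l) * x (\<sigma> l))
        = (\<Sum>l=1..L. (max 0 (r (\<sigma> l) - \<delta> l) - (\<delta> (l + 1) - \<delta> l)) * x (\<sigma> l))"
      using \<alpha>_front \<beta>_front by (intro sum.cong) simp_all
    moreover have "(\<Sum>l=L+2..N+1. (\<alpha> l - \<beta> l) * x (\<sigma> l)) = 0"
      using \<alpha>_back \<beta>_back by (intro sum.neutral) simp
    moreover have "(\<alpha> (L + 1) - \<beta> (L + 1)) * x (\<sigma> (L + 1)) = \<delta> (L + 1) - \<gamma>"
      using assortment_at_no_purchase[OF bij x] \<alpha>_L \<beta>_L unfolding L_def by simp
    ultimately show ?thesis
      unfolding dual_cut_def J_def L_def[symmetric] prod.case
        sum_split_at_no_purchase[OF LN] by simp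
  qed
  ultimately show ?thesis using that by blast
qed

text \<open>
  Two losses occur between the dual cut and the cut of its levels \<open>d\<close>. Up to position \<open>L\<close>, \<open>\<alpha>\<close> is
  replaced by its smallest feasible value. From position \<open>L + 1\<close> on, \<open>x \<le> 1\<close> and feasibility at the
  no-purchase option leave at least \<open>max 0 (d (L + 1))\<close>. The truncation lemma starts from exactly
  this value.
\<close>

lemma dual_cut_bounded_below_by_J:
  assumes bij: "bij_betw \<sigma> {1..N+1} {1..N+1}"
    and r0: "r (N + 1) = 0"
    and r_nonneg: "\<And>j. j \<in> {1..N+1} \<Longrightarrow> 0 \<le> r j"
    and D: "c \<in> dual_feasible N r \<sigma>"
  obtains \<delta> where "\<delta> \<in> Delta N r \<sigma>"
    and "\<And>x. x \<in> assortments N \<Longrightarrow> J N r \<sigma> x \<delta> \<le> dual_cut N \<sigma> x c"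
proof -
  obtain \<alpha> \<beta> \<gamma> where c: "c = (\<alpha>, \<beta>, \<gamma>)" by (cases c)
  define L where "L = num_preferred N \<sigma>"
  have LN: "L \<le> N" and sL: "\<sigma> (L + 1) = N + 1"
    using no_purchase_position[OF bij] unfolding L_def by auto
  define R where "R = max_revenue N r \<sigma>"
  have rR: "r (\<sigma> l) \<le> R" if "l \<in> {1..L+1}" for l
    unfolding R_def max_revenue_def L_def[symmetric] using that by (intro Max_ge) auto
  have R0: "0 \<le> R" using rR[of "L + 1"] sL r0 by simp
  define d where "d l = \<gamma> - (\<Sum>l'=l..N+1. \<beta> l')" for l
  have feas: "r (\<sigma> l) \<le> \<alpha> l + d l" "0 \<le> \<alpha> l" "0 \<le> \<beta> l" if "l \<in> {1..N+1}" for l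
    using D that unfolding c dual_feasible_def d_def by (auto simp: algebra_simps)
  have step: "d (l + 1) = d l + \<beta> l" if "l \<in> {1..N+1}" for l
    using that sum.atLeast_Suc_atMost[of l "N + 1" \<beta>] unfolding d_def by simp
  define \<tau> where "\<tau> l = max 0 (min R (d l))" for l
  define \<delta> where "\<delta> = restrict \<tau> {1..L+1}"
  have d_mono: "d l \<le> d (l + 1)" if "l \<in> {1..L}" for l
    using that LN step[of l] feas(3)[of l] by simp
  have "\<delta> \<in> Delta N r \<sigma>"
  proof -
    have "\<tau> l \<le> \<tau> (l + 1)" if "l \<in> {1..L}" for l
      using d_mono[OF that] unfolding \<tau>_def by auto
    then show ?thesis
      unfolding Delta_def L_def[symmetric] R_def[symmetric] \<delta>_def using R0
      by (auto simp: \<tau>_def)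
  qed
  moreover have "J N r \<sigma> x \<delta> \<le> dual_cut N \<sigma> x c" if x: "x \<in> assortments N" for x
  proof -
    have x01: "0 \<le> x (\<sigma> l) \<and> x (\<sigma> l) \<le> 1" if "l \<in> {1..N+1}" for l
      using assortment_at_position[OF bij x that] .
    have front: "(\<Sum>l=1..L. (max (r (\<sigma> l)) (d l) - d (l + 1)) * x (\<sigma> l))
        \<le> (\<Sum>l=1..L. (\<alpha> l - \<beta> l) * x (\<sigma> l))"
    proof (intro sum_mono mult_right_mono)
      fix l assume "l \<in> {1..L}"
      then have l: "l \<in> {1..N+1}" using LN by auto
      show "max (r (\<sigma> l)) (d l) - d (l + 1) \<le> \<alpha> l - \<beta> l"
        using feas[OF l] step[OF l] by simp
      show "0 \<le> x (\<sigma> l)" using x01[OF l] by simp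
    qed
    have "(\<Sum>l=L+2..N+1. - \<beta> l) \<le> (\<Sum>l=L+2..N+1. (\<alpha> l - \<beta> l) * x (\<sigma> l))"
    proof (intro sum_mono)
      fix l assume "l \<in> {L+2..N+1}"
      then have l: "l \<in> {1..N+1}" by auto
      have "0 \<le> \<alpha> l * x (\<sigma> l)" using feas(2)[OF l] x01[OF l] by simp
      moreover have "\<beta> l * x (\<sigma> l) \<le> \<beta> l" using feas(3)[OF l] x01[OF l] by (intro mult_left_le) auto
      ultimately show "- \<beta> l \<le> (\<alpha> l - \<beta> l) * x (\<sigma> l)" by (simp add: left_diff_distrib)
    qed
    moreover have "d (L + 1) = \<gamma> - \<beta> (L + 1) + (\<Sum>l=L+2..N+1. - \<beta> l)"
      using LN sum.atLeast_Suc_atMost[of "L + 1" "N + 1" \<beta>] unfolding d_def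
      by (simp add: sum_negf)
    moreover have "max 0 (d (L + 1)) \<le> d (L + 1) + \<alpha> (L + 1)"
      using feas(1,2)[of "L + 1"] LN sL r0 by simp
    ultimately have rear: "max 0 (d (L + 1))
        \<le> \<gamma> + (\<alpha> (L + 1) - \<beta> (L + 1)) + (\<Sum>l=L+2..N+1. (\<alpha> l - \<beta> l) * x (\<sigma> l))"
      by linarith
    have "J N r \<sigma> x \<delta> = \<tau> (L + 1) + (\<Sum>l=1..L. (max (r (\<sigma> l)) (\<tau> l) - \<tau> (l + 1)) * x (\<sigma> l))"
      unfolding J_eq_max L_def[symmetric] \<delta>_def by simp
    also have "\<dots> \<le> max 0 (d (L + 1))
        + (\<Sum>l=1..L. (max (r (\<sigma> l)) (d l) - d (l + 1)) * x (\<sigma> l))"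
      unfolding \<tau>_def
    proof (rule truncating_levels_lowers_cut[OF R0])
      fix l assume lL: "l \<in> {1..L}"
      then have l: "l \<in> {1..N+1}" using LN by auto
      then have "\<sigma> l \<in> {1..N+1}" using bij_betwE[OF bij] by blast
      then show "0 \<le> r (\<sigma> l) \<and> r (\<sigma> l) \<le> R" using r_nonneg rR[of l] lL by auto
      show "0 \<le> x (\<sigma> l) \<and> x (\<sigma> l) \<le> 1" using x01[OF l] .
      show "d l \<le> d (l + 1)" using d_mono[OF lL] .
    qed
    also have "\<dots> \<le> dual_cut N \<sigma> x c"
    proof -
      have "(\<alpha> (L + 1) - \<beta> (L + 1)) * x (\<sigma> (L + 1)) = \<alpha> (L + 1) - \<beta> (L + 1)"
        using assortment_at_no_purchase[OF bij x] unfolding L_def by simp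
      then show ?thesis
        using front rear unfolding c dual_cut_def prod.case sum_split_at_no_purchase[OF LN]
        by linarith
    qed
    finally show ?thesis .
  qed
  ultimately show ?thesis using that by blast
qed

theorem theorem2:
  fixes N K k :: nat and r :: "nat \<Rightarrow> real" and i :: "nat \<Rightarrow> nat \<Rightarrow> nat"
    and xhat \<delta> :: "nat \<Rightarrow> real"
  assumes "\<forall>j\<in>{1..N}. r j > 0" and "r (N + 1) = 0"
    and "\<forall>k\<in>{1..K}. bij_betw (i k) {1..N+1} {1..N+1}"
    and "\<forall>k\<in>{1..K}. num_preferred N (i k) \<ge> 1"
    and "k \<in> {1..K}"
    and "xhat \<in> assortments N"
    and "is_arg_min (J N r (i k) xhat) (\<lambda>d. d \<in> Delta N r (i k)) \<delta>"
  shows "\<exists>\<alpha> \<beta> \<gamma>.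
    (\<alpha>, \<beta>, \<gamma>) \<in> dual_feasible N r (i k) \<and>
    is_arg_min (dual_cut N (i k) xhat) (\<lambda>d. d \<in> dual_feasible N r (i k)) (\<alpha>, \<beta>, \<gamma>) \<and>
    (\<forall>x\<in>assortments N. J N r (i k) x \<delta> = dual_cut N (i k) x (\<alpha>, \<beta>, \<gamma>)) \<and>
    (pareto_cut (assortments N) (J N r (i k)) (Delta N r (i k)) \<delta> \<longrightarrow>
     pareto_cut (assortments N) (dual_cut N (i k)) (dual_feasible N r (i k)) (\<alpha>, \<beta>, \<gamma>))"
proof -
  define \<sigma> where "\<sigma> = i k"
  have bij: "bij_betw \<sigma> {1..N+1} {1..N+1}" using assms(3,5) unfolding \<sigma>_def by blast
  have r_nonneg: "0 \<le> r j" if "j \<in> {1..N+1}" for j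
    using assms(1,2) that by (cases "j = N + 1") (auto intro: less_imp_le)
  have \<delta>: "\<delta> \<in> Delta N r \<sigma>"
    and opt: "\<And>d. d \<in> Delta N r \<sigma> \<Longrightarrow> J N r \<sigma> xhat \<delta> \<le> J N r \<sigma> xhat d"
    using assms(7) unfolding is_arg_min_linorder \<sigma>_def by auto
  obtain \<alpha> \<beta> \<gamma> where D: "(\<alpha>, \<beta>, \<gamma>) \<in> dual_feasible N r \<sigma>"
    and eq: "\<And>x. x \<in> assortments N \<Longrightarrow> J N r \<sigma> x \<delta> = dual_cut N \<sigma> x (\<alpha>, \<beta>, \<gamma>)"
    using dual_point_with_same_cut[where N = N and r = r and \<sigma> = \<sigma>, OF bij assms(2) \<delta>] by blast
  have "is_arg_min (dual_cut N \<sigma> xhat) (\<lambda>d. d \<in> dual_feasible N r \<sigma>) (\<alpha>, \<beta>, \<gamma>)"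
    unfolding is_arg_min_linorder
  proof (intro conjI allI impI D)
    fix c assume "c \<in> dual_feasible N r \<sigma>"
    then obtain \<delta>' where \<delta>': "\<delta>' \<in> Delta N r \<sigma>"
      and le: "\<And>x. x \<in> assortments N \<Longrightarrow> J N r \<sigma> x \<delta>' \<le> dual_cut N \<sigma> x c"
      using dual_cut_bounded_below_by_J[where N = N and r = r and \<sigma> = \<sigma>, OF bij assms(2) r_nonneg]
      by blast
    show "dual_cut N \<sigma> xhat (\<alpha>, \<beta>, \<gamma>) \<le> dual_cut N \<sigma> xhat c"
      using eq[OF assms(6)] opt[OF \<delta>'] le[OF assms(6)] by linarith
  qed
  moreover have "pareto_cut (assortments N) (dual_cut N \<sigma>) (dual_feasible N r \<sigma>) (\<alpha>, \<beta>, \<gamma>)"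
    if par: "pareto_cut (assortments N) (J N r \<sigma>) (Delta N r \<sigma>) \<delta>"
    unfolding pareto_cut_def
  proof (intro conjI notI D)
    assume "\<exists>c\<in>dual_feasible N r \<sigma>. dominates (assortments N) (dual_cut N \<sigma>) c (\<alpha>, \<beta>, \<gamma>)"
    then obtain c where c: "c \<in> dual_feasible N r \<sigma>"
      and dom: "dominates (assortments N) (dual_cut N \<sigma>) c (\<alpha>, \<beta>, \<gamma>)" by blast
    obtain \<delta>' where \<delta>': "\<delta>' \<in> Delta N r \<sigma>"
      and le: "\<And>x. x \<in> assortments N \<Longrightarrow> J N r \<sigma> x \<delta>' \<le> dual_cut N \<sigma> x c"
      using dual_cut_bounded_below_by_J[where N = N and r = r and \<sigma> = \<sigma>, OF bij assms(2) r_nonneg c]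
      by blast
    have "dominates (assortments N) (J N r \<sigma>) \<delta>' \<delta>"
      unfolding dominates_def
    proof (intro conjI ballI)
      show "J N r \<sigma> x \<delta>' \<le> J N r \<sigma> x \<delta>" if x: "x \<in> assortments N" for x
        using dom le[OF x] eq[OF x] x unfolding dominates_def by fastforce
      obtain x where x: "x \<in> assortments N"
        and "dual_cut N \<sigma> x c < dual_cut N \<sigma> x (\<alpha>, \<beta>, \<gamma>)"
        using dom unfolding dominates_def by blast
      then have "J N r \<sigma> x \<delta>' < J N r \<sigma> x \<delta>" using le[OF x] eq[OF x] by linarith
      then show "\<exists>x\<in>assortments N. J N r \<sigma> x \<delta>' < J N r \<sigma> x \<delta>" using x by blast
    qed
    then show False using par \<delta>' unfolding pareto_cut_def by blast
  qed
  ultimately show ?thesis using D eq unfolding \<sigma>_def by blast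
qed

end
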